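(* The sequent calculus $\mathsf{GwIK}_t$ admits cut-elimination: every sequent derivable in $\mathsf{GwIK}_t$ is derivable in $\mathsf{GwIK}_t$ without any application of the rule $(\mathrm{Cut})$.
   Context: Formulas: the set $\mathcal{F}$ is generated by $\alpha ::= p \mid \top \mid \bot \mid (\alpha_1\to\alpha_2)\mid(\alpha_1\wedge\alpha_2)\mid(\alpha_1\vee\alpha_2)\mid\Diamond\alpha\mid\Box\alpha\mid\mathsf{P}\alpha\mid\blacksquare\alpha$, with $p$ from a denumerable set $\mathbf{Var}$ of variables; $\Diamond,\Box,\mathsf{P},\blacksquare$ are four unary (tense) connectives. Structures: the set $\mathcal{FS}$ of formula structures is generated by $\Gamma ::= \alpha\mid(\Gamma_1,\Gamma_2)\mid\circ\Gamma\mid\bullet\Gamma$ with $\alpha\in\mathcal{F}$ (the comma is a binary structure operator, $\circ$ and $\bullet$ are unary ones); $\mathcal{FS}^\epsilon=\mathcal{FS}\cup\{\epsilon\}$ where $\epsilon$ is the empty structure. A sequent is an expression $\Gamma\Rightarrow\beta$ with $\Gamma\in\mathcal{FS}^\epsilon$, $\beta\in\mathcal{F}$. Contexts: $\Gamma[-] ::= -\mid(\Gamma_1[-],\Gamma_2)\mid(\Gamma_1,\Gamma_2[-])\mid\circ\Gamma[-]\mid\bullet\Gamma[-]$, where the side components are formula structures; $\Gamma[\Delta]$ is the structure obtained by putting $\Delta\in\mathcal{FS}$ in the position $-$. In rule $({\to}\mathrm{R})$ below, when $\Gamma=\epsilon$ the expression $\beta_1,\Gamma$ is read as $\beta_1$.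 The calculus $\mathsf{GwIK}_t$ has the following axioms and rules (written "premises / conclusion", $i\in\{1,2\}$). Axiom: $(\mathrm{Id})$ $\alpha\Rightarrow\alpha$ for every formula $\alpha$. Logical rules: $(\top)$ $\Gamma[\top]\Rightarrow\beta$ / $\Gamma[\Delta]\Rightarrow\beta$; $(\bot)$ $\Delta\Rightarrow\bot$ / $\Gamma[\Delta]\Rightarrow\beta$; $({\wedge}\mathrm{L})$ $\Gamma[\alpha_1,\alpha_2]\Rightarrow\beta$ / $\Gamma[\alpha_1\wedge\alpha_2]\Rightarrow\beta$; $({\wedge}\mathrm{R})$ $\Gamma\Rightarrow\beta_1$ and $\Gamma\Rightarrow\beta_2$ / $\Gamma\Rightarrow\beta_1\wedge\beta_2$; $({\vee}\mathrm{L})$ $\Gamma[\alpha_1]\Rightarrow\beta$ and $\Gamma[\alpha_2]\Rightarrow\beta$ / $\Gamma[\alpha_1\vee\alpha_2]\Rightarrow\beta$; $({\vee}\mathrm{R})$ $\Gamma\Rightarrow\beta_i$ / $\Gamma\Rightarrow\beta_1\vee\beta_2$; $({\to}\mathrm{L})$ $\Delta\Rightarrow\alpha_1$ and $\Gamma[\alpha_2]\Rightarrow\beta$ / $\Gamma[\Delta,\alpha_1\to\alpha_2]\Rightarrow\beta$; $({\to}\mathrm{R})$ $\beta_1,\Gamma\Rightarrow\beta_2$ / $\Gamma\Rightarrow\beta_1\to\beta_2$. Tense rules: $(\Diamond\mathrm{L})$ $\Gamma[\circ\alpha]\Rightarrow\beta$ / $\Gamma[\Diamond\alpha]\Rightarrow\beta$;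 $(\Diamond\mathrm{R})$ $\Gamma\Rightarrow\beta$ / $\circ\Gamma\Rightarrow\Diamond\beta$; $(\mathsf{P}\mathrm{L})$ $\Gamma[\bullet\alpha]\Rightarrow\beta$ / $\Gamma[\mathsf{P}\alpha]\Rightarrow\beta$; $(\mathsf{P}\mathrm{R})$ $\Gamma\Rightarrow\beta$ / $\bullet\Gamma\Rightarrow\mathsf{P}\beta$; $(\blacksquare\mathrm{L})$ $\Gamma[\alpha]\Rightarrow\beta$ / $\Gamma[\circ\blacksquare\alpha]\Rightarrow\beta$; $(\blacksquare\mathrm{R})$ $\circ\Gamma\Rightarrow\beta$ / $\Gamma\Rightarrow\blacksquare\beta$; $(\Box\mathrm{L})$ $\Gamma[\alpha]\Rightarrow\beta$ / $\Gamma[\bullet\Box\alpha]\Rightarrow\beta$; $(\Box\mathrm{R})$ $\bullet\Gamma\Rightarrow\beta$ / $\Gamma\Rightarrow\Box\beta$. Structural rules: $(\mathrm{Con}_\circ)$ $\Gamma[\circ\Delta_1,\circ\Delta_2]\Rightarrow\beta$ / $\Gamma[\circ(\Delta_1,\Delta_2)]\Rightarrow\beta$; $(\mathrm{Con}_\bullet)$ $\Gamma[\bullet\Delta_1,\bullet\Delta_2]\Rightarrow\beta$ / $\Gamma[\bullet(\Delta_1,\Delta_2)]\Rightarrow\beta$; $(\mathrm{Con_F})$ $\Gamma[\alpha,\alpha]\Rightarrow\beta$ / $\Gamma[\alpha]\Rightarrow\beta$ for every formula $\alpha$; $(\mathrm{Wk})$ $\Gamma[\Delta_i]\Rightarrow\beta$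 / $\Gamma[\Delta_1,\Delta_2]\Rightarrow\beta$; $(\mathrm{Ex})$ $\Gamma[\Delta_1,\Delta_2]\Rightarrow\beta$ / $\Gamma[\Delta_2,\Delta_1]\Rightarrow\beta$; $(\mathrm{Dual}_{\circ\bullet})$ $\circ\Delta_1,\Delta_2\Rightarrow\bot$ / $\Gamma[\Delta_1,\bullet\Delta_2]\Rightarrow\beta$; $(\mathrm{Dual}_{\bullet\circ})$ $\bullet\Delta_1,\Delta_2\Rightarrow\bot$ / $\Gamma[\Delta_1,\circ\Delta_2]\Rightarrow\beta$. Cut rule: $(\mathrm{Cut})$ $\Delta\Rightarrow\alpha$ and $\Gamma[\alpha]\Rightarrow\beta$ / $\Gamma[\Delta]\Rightarrow\beta$.
   Formalization: The comma is read as associative: derivations, also those without (Cut), may re-bracket commas freely. With no associativity the claim is false: p,(q,((p∧q)→r)) ⇒ r is derivable with (Cut) but not without it. The sequents derivable with (Cut) are unchanged. *)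

theory Defs
  imports Main
begin

type_synonym var = nat

datatype fm =
    Var var
  | Top
  | Bot
  | Imp fm fm  (infixr "\<^bold>\<rightarrow>" 65)
  | And fm fm  (infixr "\<^bold>\<and>" 75)
  | Or fm fm   (infixr "\<^bold>\<or>" 70)
  | Dia fm     ("\<^bold>\<diamond>")
  | Box fm     ("\<^bold>\<box>")
  | Past fm    ("\<^bold>P")
  | BBox fm    ("\<^bold>\<box>\<^sub>P")  \<comment> \<open>the black box\<close>

datatype struct =
    Fm fm
  | Comma struct struct  (infixr "\<^bold>," 60)
  | Circ struct          ("\<^bold>\<circ>")
  | Bul struct           ("\<^bold>\<bullet>")

datatype ctx =
    Hole
  | CommaL ctx struct
  | CommaR struct ctx
  | CircC ctx
  | BulC ctx

fun fill :: "ctx \<Rightarrow> struct \<Rightarrow> struct"  ("_\<langle>_\<rangle>" [1000, 0] 1000) where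
  "fill Hole \<Delta> = \<Delta>"
| "fill (CommaL C \<Gamma>) \<Delta> = (fill C \<Delta> \<^bold>, \<Gamma>)"
| "fill (CommaR \<Gamma> C) \<Delta> = (\<Gamma> \<^bold>, fill C \<Delta>)"
| "fill (CircC C) \<Delta> = \<^bold>\<circ> (fill C \<Delta>)"
| "fill (BulC C) \<Delta> = \<^bold>\<bullet> (fill C \<Delta>)"

text \<open>
  The antecedent of a sequent is a structure or empty; \<open>None\<close> is the empty structure.
  Only the rules \<open>AndR\<close>, \<open>OrR\<close> and \<open>ImpR\<close> can have an empty antecedent, since neither
  the operators on structures nor a context can be applied to the empty structure.
\<close>

datatype sequent = Sequent "struct option" fm  (infix "\<^bold>\<Rightarrow>" 50)

fun fm_comma :: "fm \<Rightarrow> struct option \<Rightarrow> struct" where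
  "fm_comma \<alpha> None = Fm \<alpha>"
| "fm_comma \<alpha> (Some \<Gamma>) = (Fm \<alpha> \<^bold>, \<Gamma>)"

datatype rule_name =
    Id | TopRule | BotRule | AndL | AndR | OrL | OrR | ImpL | ImpR
  | DiaL | DiaR | PastL | PastR | BBoxL | BBoxR | BoxL | BoxR
  | ConCirc | ConBul | ConF | Wk | Ex | DualCircBul | DualBulCirc
  | Cut

text \<open>\<open>rule_inst r ps s\<close>: the rule \<open>r\<close> leads from the premises \<open>ps\<close> to the conclusion \<open>s\<close>.\<close>

inductive rule_inst :: "rule_name \<Rightarrow> sequent list \<Rightarrow> sequent \<Rightarrow> bool" where
  Id: "rule_inst Id [] (Some (Fm \<alpha>) \<^bold>\<Rightarrow> \<alpha>)"

| TopRule: "rule_inst TopRule [Some (C\<langle>Fm Top\<rangle>) \<^bold>\<Rightarrow> \<beta>] (Some (C\<langle>\<Delta>\<rangle>) \<^bold>\<Rightarrow> \<beta>)"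
| BotRule: "rule_inst BotRule [Some \<Delta> \<^bold>\<Rightarrow> Bot] (Some (C\<langle>\<Delta>\<rangle>) \<^bold>\<Rightarrow> \<beta>)"
| AndL: "rule_inst AndL [Some (C\<langle>Fm \<alpha>1 \<^bold>, Fm \<alpha>2\<rangle>) \<^bold>\<Rightarrow> \<beta>] (Some (C\<langle>Fm (\<alpha>1 \<^bold>\<and> \<alpha>2)\<rangle>) \<^bold>\<Rightarrow> \<beta>)"
| AndR: "rule_inst AndR [\<Gamma> \<^bold>\<Rightarrow> \<beta>1, \<Gamma> \<^bold>\<Rightarrow> \<beta>2] (\<Gamma> \<^bold>\<Rightarrow> \<beta>1 \<^bold>\<and> \<beta>2)"
| OrL: "rule_inst OrL [Some (C\<langle>Fm \<alpha>1\<rangle>) \<^bold>\<Rightarrow> \<beta>, Some (C\<langle>Fm \<alpha>2\<rangle>) \<^bold>\<Rightarrow> \<beta>]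
    (Some (C\<langle>Fm (\<alpha>1 \<^bold>\<or> \<alpha>2)\<rangle>) \<^bold>\<Rightarrow> \<beta>)"
| OrR1: "rule_inst OrR [\<Gamma> \<^bold>\<Rightarrow> \<beta>1] (\<Gamma> \<^bold>\<Rightarrow> \<beta>1 \<^bold>\<or> \<beta>2)"
| OrR2: "rule_inst OrR [\<Gamma> \<^bold>\<Rightarrow> \<beta>2] (\<Gamma> \<^bold>\<Rightarrow> \<beta>1 \<^bold>\<or> \<beta>2)"
| ImpL: "rule_inst ImpL [Some \<Delta> \<^bold>\<Rightarrow> \<alpha>1, Some (C\<langle>Fm \<alpha>2\<rangle>) \<^bold>\<Rightarrow> \<beta>]
    (Some (C\<langle>\<Delta> \<^bold>, Fm (\<alpha>1 \<^bold>\<rightarrow> \<alpha>2)\<rangle>) \<^bold>\<Rightarrow> \<beta>)"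
| ImpR: "rule_inst ImpR [Some (fm_comma \<beta>1 \<Gamma>) \<^bold>\<Rightarrow> \<beta>2] (\<Gamma> \<^bold>\<Rightarrow> \<beta>1 \<^bold>\<rightarrow> \<beta>2)"

| DiaL: "rule_inst DiaL [Some (C\<langle>\<^bold>\<circ> (Fm \<alpha>)\<rangle>) \<^bold>\<Rightarrow> \<beta>] (Some (C\<langle>Fm (\<^bold>\<diamond> \<alpha>)\<rangle>) \<^bold>\<Rightarrow> \<beta>)"
| DiaR: "rule_inst DiaR [Some \<Gamma> \<^bold>\<Rightarrow> \<beta>] (Some (\<^bold>\<circ> \<Gamma>) \<^bold>\<Rightarrow> \<^bold>\<diamond> \<beta>)"
| PastL: "rule_inst PastL [Some (C\<langle>\<^bold>\<bullet> (Fm \<alpha>)\<rangle>) \<^bold>\<Rightarrow> \<beta>] (Some (C\<langle>Fm (\<^bold>P \<alpha>)\<rangle>) \<^bold>\<Rightarrow> \<beta>)"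
| PastR: "rule_inst PastR [Some \<Gamma> \<^bold>\<Rightarrow> \<beta>] (Some (\<^bold>\<bullet> \<Gamma>) \<^bold>\<Rightarrow> \<^bold>P \<beta>)"
| BBoxL: "rule_inst BBoxL [Some (C\<langle>Fm \<alpha>\<rangle>) \<^bold>\<Rightarrow> \<beta>] (Some (C\<langle>\<^bold>\<circ> (Fm (\<^bold>\<box>\<^sub>P \<alpha>))\<rangle>) \<^bold>\<Rightarrow> \<beta>)"
| BBoxR: "rule_inst BBoxR [Some (\<^bold>\<circ> \<Gamma>) \<^bold>\<Rightarrow> \<beta>] (Some \<Gamma> \<^bold>\<Rightarrow> \<^bold>\<box>\<^sub>P \<beta>)"
| BoxL: "rule_inst BoxL [Some (C\<langle>Fm \<alpha>\<rangle>) \<^bold>\<Rightarrow> \<beta>] (Some (C\<langle>\<^bold>\<bullet> (Fm (\<^bold>\<box> \<alpha>))\<rangle>) \<^bold>\<Rightarrow> \<beta>)"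
| BoxR: "rule_inst BoxR [Some (\<^bold>\<bullet> \<Gamma>) \<^bold>\<Rightarrow> \<beta>] (Some \<Gamma> \<^bold>\<Rightarrow> \<^bold>\<box> \<beta>)"

| ConCirc: "rule_inst ConCirc [Some (C\<langle>\<^bold>\<circ> \<Delta>1 \<^bold>, \<^bold>\<circ> \<Delta>2\<rangle>) \<^bold>\<Rightarrow> \<beta>]
    (Some (C\<langle>\<^bold>\<circ> (\<Delta>1 \<^bold>, \<Delta>2)\<rangle>) \<^bold>\<Rightarrow> \<beta>)"
| ConBul: "rule_inst ConBul [Some (C\<langle>\<^bold>\<bullet> \<Delta>1 \<^bold>, \<^bold>\<bullet> \<Delta>2\<rangle>) \<^bold>\<Rightarrow> \<beta>]
    (Some (C\<langle>\<^bold>\<bullet> (\<Delta>1 \<^bold>, \<Delta>2)\<rangle>) \<^bold>\<Rightarrow> \<beta>)"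
| ConF: "rule_inst ConF [Some (C\<langle>Fm \<alpha> \<^bold>, Fm \<alpha>\<rangle>) \<^bold>\<Rightarrow> \<beta>] (Some (C\<langle>Fm \<alpha>\<rangle>) \<^bold>\<Rightarrow> \<beta>)"
| Wk1: "rule_inst Wk [Some (C\<langle>\<Delta>1\<rangle>) \<^bold>\<Rightarrow> \<beta>] (Some (C\<langle>\<Delta>1 \<^bold>, \<Delta>2\<rangle>) \<^bold>\<Rightarrow> \<beta>)"
| Wk2: "rule_inst Wk [Some (C\<langle>\<Delta>2\<rangle>) \<^bold>\<Rightarrow> \<beta>] (Some (C\<langle>\<Delta>1 \<^bold>, \<Delta>2\<rangle>) \<^bold>\<Rightarrow> \<beta>)"
| Ex: "rule_inst Ex [Some (C\<langle>\<Delta>1 \<^bold>, \<Delta>2\<rangle>) \<^bold>\<Rightarrow> \<beta>] (Some (C\<langle>\<Delta>2 \<^bold>, \<Delta>1\<rangle>) \<^bold>\<Rightarrow> \<beta>)"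
| DualCircBul: "rule_inst DualCircBul [Some (\<^bold>\<circ> \<Delta>1 \<^bold>, \<Delta>2) \<^bold>\<Rightarrow> Bot]
    (Some (C\<langle>\<Delta>1 \<^bold>, \<^bold>\<bullet> \<Delta>2\<rangle>) \<^bold>\<Rightarrow> \<beta>)"
| DualBulCirc: "rule_inst DualBulCirc [Some (\<^bold>\<bullet> \<Delta>1 \<^bold>, \<Delta>2) \<^bold>\<Rightarrow> Bot]
    (Some (C\<langle>\<Delta>1 \<^bold>, \<^bold>\<circ> \<Delta>2\<rangle>) \<^bold>\<Rightarrow> \<beta>)"

| Cut: "rule_inst Cut [Some \<Delta> \<^bold>\<Rightarrow> \<alpha>, Some (C\<langle>Fm \<alpha>\<rangle>) \<^bold>\<Rightarrow> \<beta>] (Some (C\<langle>\<Delta>\<rangle>) \<^bold>\<Rightarrow> \<beta>)"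

text \<open>
  The comma is read as associative: structures that differ only in the bracketing of
  commas are identified. Without this identification
  \<open>p, (q, (p \<and> q \<rightarrow> r)) \<Rightarrow> r\<close> is derivable with cut but has no cut-free derivation;
  in the presence of cut it adds no derivable sequents.
\<close>

inductive assoc_eq :: "struct \<Rightarrow> struct \<Rightarrow> bool"  (infix "\<approx>" 50) where
  assoc: "((\<Gamma> \<^bold>, \<Delta>) \<^bold>, \<Sigma>) \<approx> (\<Gamma> \<^bold>, (\<Delta> \<^bold>, \<Sigma>))"
| refl: "\<Gamma> \<approx> \<Gamma>"
| sym: "\<Gamma> \<approx> \<Delta> \<Longrightarrow> \<Delta> \<approx> \<Gamma>"
| trans: "\<Gamma> \<approx> \<Delta> \<Longrightarrow> \<Delta> \<approx> \<Sigma> \<Longrightarrow> \<Gamma> \<approx> \<Sigma>"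
| ctx: "\<Gamma> \<approx> \<Delta> \<Longrightarrow> C\<langle>\<Gamma>\<rangle> \<approx> C\<langle>\<Delta>\<rangle>"

inductive derivable :: "rule_name set \<Rightarrow> sequent \<Rightarrow> bool" for R where
  rule: "r \<in> R \<Longrightarrow> rule_inst r ps s \<Longrightarrow> (\<And>p. p \<in> set ps \<Longrightarrow> derivable R p) \<Longrightarrow> derivable R s"
| bracketing: "derivable R (Some \<Gamma> \<^bold>\<Rightarrow> \<beta>) \<Longrightarrow> \<Gamma> \<approx> \<Gamma>' \<Longrightarrow> derivable R (Some \<Gamma>' \<^bold>\<Rightarrow> \<beta>)"

definition GwIKt :: "rule_name set" where
  "GwIKt = UNIV"

end

theory Submission
  imports Defs
begin

text \<open>
  Contraction is admissible for arbitrary structures: under \<open>\<circ>\<close> and \<open>\<bullet>\<close> it follows from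
  \<open>Con\<^sub>\<circ>\<close> and \<open>Con\<^sub>\<bullet>\<close>, under the comma from exchange and associativity. Cut is eliminated by
  induction on the cut formula \<open>\<alpha>\<close>, and for fixed \<open>\<alpha>\<close> by induction on the derivation of
  \<open>\<Delta> \<Rightarrow> \<alpha>\<close>. Every rule acting on the antecedent permutes below the cut. If the last rule
  introduces \<open>\<alpha>\<close> on the right, an induction on the derivation of the other premise replaces
  any number of occurrences of \<open>\<alpha>\<close> by \<open>\<Delta>\<close> at once, so that a contraction of \<open>\<alpha>\<close> becomes a
  contraction of \<open>\<Delta>\<close>; only where \<open>\<alpha>\<close> is principal on the left are cuts on immediate
  subformulas needed.
\<close>

section \<open>Composition of contexts and the rules other than \<open>Cut\<close>\<close>

fun ctx_comp :: "ctx \<Rightarrow> ctx \<Rightarrow> ctx" where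
  "ctx_comp Hole D = D"
| "ctx_comp (CommaL C \<Gamma>) D = CommaL (ctx_comp C D) \<Gamma>"
| "ctx_comp (CommaR \<Gamma> C) D = CommaR \<Gamma> (ctx_comp C D)"
| "ctx_comp (CircC C) D = CircC (ctx_comp C D)"
| "ctx_comp (BulC C) D = BulC (ctx_comp C D)"

lemma fill_ctx_comp: "(ctx_comp C D)\<langle>\<Delta>\<rangle> = C\<langle>D\<langle>\<Delta>\<rangle>\<rangle>"
  by (induction C) auto

abbreviation cut_free :: "sequent \<Rightarrow> bool" where
  "cut_free \<equiv> derivable (GwIKt - {Cut})"

lemma cut_free_rule:
  assumes "rule_inst r ps s" "r \<noteq> Cut" "\<forall>p\<in>set ps. cut_free p"
  shows "cut_free s"
  using assms by (auto intro: derivable.rule simp: GwIKt_def)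

text \<open>The indices follow the order of the introduction rules of \<open>rule_inst\<close>.
  \<open>Cut\<close> is the 27th and is left out.\<close>

lemmas cut_free_intros =
  rule_inst.intros(1-26)[THEN cut_free_rule, simplified]

lemmas cut_free_bracketing = derivable.bracketing[where R = "GwIKt - {Cut}"]

section \<open>Structural contraction\<close>

text \<open>Rebracketing puts the two inner components side by side under one comma, where a single
  exchange can swap them.\<close>

lemma assoc_eq_interchange:
  "C\<langle>(\<Gamma> \<^bold>, \<Delta>) \<^bold>, (\<Gamma> \<^bold>, \<Delta>)\<rangle> \<approx> C\<langle>\<Gamma> \<^bold>, ((\<Delta> \<^bold>, \<Gamma>) \<^bold>, \<Delta>)\<rangle>"
  by (intro assoc_eq.ctx)
    (metis assoc_eq.assoc assoc_eq.sym assoc_eq.trans assoc_eq.ctx[where C = "CommaR _ Hole"] fill.simps)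

lemma cut_free_contraction:
  "cut_free (Some (C\<langle>\<Delta> \<^bold>, \<Delta>\<rangle>) \<^bold>\<Rightarrow> \<beta>) \<Longrightarrow> cut_free (Some (C\<langle>\<Delta>\<rangle>) \<^bold>\<Rightarrow> \<beta>)"
proof (induction \<Delta> arbitrary: C)
  case (Fm \<alpha>)
  then show ?case by (rule cut_free_intros(21))
next
  case (Comma \<Delta>1 \<Delta>2)
  have "cut_free (Some (C\<langle>\<Delta>1 \<^bold>, ((\<Delta>2 \<^bold>, \<Delta>1) \<^bold>, \<Delta>2)\<rangle>) \<^bold>\<Rightarrow> \<beta>)"
    using Comma.prems assoc_eq_interchange by (rule cut_free_bracketing)
  \<comment> \<open>The exchange happens at the inner pair, so everything around that pair is read
    as one context.\<close>
  then have "cut_free (Some ((ctx_comp C (CommaR \<Delta>1 (CommaL Hole \<Delta>2)))\<langle>\<Delta>2 \<^bold>, \<Delta>1\<rangle>) \<^bold>\<Rightarrow> \<beta>)"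
    by (simp add: fill_ctx_comp)
  then have "cut_free (Some ((ctx_comp C (CommaR \<Delta>1 (CommaL Hole \<Delta>2)))\<langle>\<Delta>1 \<^bold>, \<Delta>2\<rangle>) \<^bold>\<Rightarrow> \<beta>)"
    by (rule cut_free_intros(24))
  then have "cut_free (Some (C\<langle>\<Delta>1 \<^bold>, ((\<Delta>1 \<^bold>, \<Delta>2) \<^bold>, \<Delta>2)\<rangle>) \<^bold>\<Rightarrow> \<beta>)"
    by (simp add: fill_ctx_comp)
  moreover have "C\<langle>\<Delta>1 \<^bold>, ((\<Delta>1 \<^bold>, \<Delta>2) \<^bold>, \<Delta>2)\<rangle> \<approx> C\<langle>(\<Delta>1 \<^bold>, \<Delta>1) \<^bold>, (\<Delta>2 \<^bold>, \<Delta>2)\<rangle>"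
    by (intro assoc_eq.ctx)
      (metis assoc_eq.assoc assoc_eq.sym assoc_eq.trans
        assoc_eq.ctx[where C = "CommaR _ Hole"] fill.simps)
  ultimately have "cut_free (Some (C\<langle>(\<Delta>1 \<^bold>, \<Delta>1) \<^bold>, (\<Delta>2 \<^bold>, \<Delta>2)\<rangle>) \<^bold>\<Rightarrow> \<beta>)"
    by (rule cut_free_bracketing)
  \<comment> \<open>The doubled components now stand next to each other. Each is contracted by its
    own induction hypothesis, which is why the context is kept arbitrary.\<close>
  then have "cut_free (Some (C\<langle>\<Delta>1 \<^bold>, (\<Delta>2 \<^bold>, \<Delta>2)\<rangle>) \<^bold>\<Rightarrow> \<beta>)"
    using Comma.IH(1)[of "ctx_comp C (CommaL Hole (\<Delta>2 \<^bold>, \<Delta>2))"] by (simp add: fill_ctx_comp)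
  then show ?case
    using Comma.IH(2)[of "ctx_comp C (CommaR \<Delta>1 Hole)"] by (simp add: fill_ctx_comp)
next
  case (Circ \<Delta>)
  \<comment> \<open>\<open>ConCirc\<close> moves the duplication beneath the modality, where the
    smaller structure \<Delta> is contracted in the extended context.\<close>
  then have "cut_free (Some (C\<langle>\<^bold>\<circ> (\<Delta> \<^bold>, \<Delta>)\<rangle>) \<^bold>\<Rightarrow> \<beta>)" by (auto intro: cut_free_intros(19))
  then show ?case using Circ.IH[of "ctx_comp C (CircC Hole)"] by (simp add: fill_ctx_comp)
next
  case (Bul \<Delta>)
  then have "cut_free (Some (C\<langle>\<^bold>\<bullet> (\<Delta> \<^bold>, \<Delta>)\<rangle>) \<^bold>\<Rightarrow> \<beta>)" by (auto intro: cut_free_intros(20))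
  then show ?case using Bul.IH[of "ctx_comp C (BulC Hole)"] by (simp add: fill_ctx_comp)
qed

section \<open>Replacing occurrences of a formula\<close>

text \<open>This is a relation because any selection of the occurrences of \<alpha> may be replaced:
  \<open>leaf\<close> applies to \<alpha> as well, so an occurrence can also be kept. A cut replaces
  one occurrence, but going upwards through a contraction turns it into two.\<close>

inductive repl :: "fm \<Rightarrow> struct \<Rightarrow> struct \<Rightarrow> struct \<Rightarrow> bool" for \<alpha> \<Delta> where
  hit: "repl \<alpha> \<Delta> (Fm \<alpha>) \<Delta>"
| leaf: "repl \<alpha> \<Delta> (Fm \<phi>) (Fm \<phi>)"
| Comma: "repl \<alpha> \<Delta> \<Gamma>1 \<Gamma>1' \<Longrightarrow> repl \<alpha> \<Delta> \<Gamma>2 \<Gamma>2' \<Longrightarrow> repl \<alpha> \<Delta> (\<Gamma>1 \<^bold>, \<Gamma>2) (\<Gamma>1' \<^bold>, \<Gamma>2')"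
| Circ: "repl \<alpha> \<Delta> \<Gamma> \<Gamma>' \<Longrightarrow> repl \<alpha> \<Delta> (\<^bold>\<circ> \<Gamma>) (\<^bold>\<circ> \<Gamma>')"
| Bul: "repl \<alpha> \<Delta> \<Gamma> \<Gamma>' \<Longrightarrow> repl \<alpha> \<Delta> (\<^bold>\<bullet> \<Gamma>) (\<^bold>\<bullet> \<Gamma>')"

inductive_simps repl_simps:
  "repl \<alpha> \<Delta> (Fm \<phi>) \<Gamma>'"
  "repl \<alpha> \<Delta> (\<Gamma>1 \<^bold>, \<Gamma>2) \<Gamma>'"
  "repl \<alpha> \<Delta> (\<^bold>\<circ> \<Gamma>) \<Gamma>'"
  "repl \<alpha> \<Delta> (\<^bold>\<bullet> \<Gamma>) \<Gamma>'"

lemma repl_refl: "repl \<alpha> \<Delta> \<Gamma> \<Gamma>"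
  by (induction \<Gamma>) (auto intro: repl.intros)

lemma repl_fill: "repl \<alpha> \<Delta> \<Gamma> \<Gamma>' \<Longrightarrow> repl \<alpha> \<Delta> (C\<langle>\<Gamma>\<rangle>) (C\<langle>\<Gamma>'\<rangle>)"
  by (induction C) (auto intro: repl.intros repl_refl)

text \<open>The selection made in the side structures of \<open>C\<close> is recorded in
  \<open>C'\<close>. It does not depend on the content of the hole, so the premises of a rule can be
  given the same altered context as its conclusion.\<close>

lemma repl_fillE:
  assumes "repl \<alpha> \<Delta> (C\<langle>\<Gamma>\<rangle>) \<Sigma>"
  obtains C' \<Gamma>' where "\<Sigma> = C'\<langle>\<Gamma>'\<rangle>" "repl \<alpha> \<Delta> \<Gamma> \<Gamma>'"
    "\<And>\<Theta> \<Theta>'. repl \<alpha> \<Delta> \<Theta> \<Theta>' \<Longrightarrow> repl \<alpha> \<Delta> (C\<langle>\<Theta>\<rangle>) (C'\<langle>\<Theta>'\<rangle>)"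
  using assms
proof (induction C arbitrary: \<Sigma> thesis)
  case Hole
  then show ?case using Hole.prems(1)[of Hole] by auto
next
  case (CommaL C \<Gamma>2)
  from CommaL.prems(2) obtain \<Sigma>1 \<Sigma>2
    where \<Sigma>: "\<Sigma> = (\<Sigma>1 \<^bold>, \<Sigma>2)" "repl \<alpha> \<Delta> (C\<langle>\<Gamma>\<rangle>) \<Sigma>1" "repl \<alpha> \<Delta> \<Gamma>2 \<Sigma>2"
    by (auto simp: repl_simps)
  show ?case
    by (rule CommaL.IH[OF _ \<Sigma>(2)])
      (rule CommaL.prems(1)[of "CommaL _ \<Sigma>2"], auto simp: \<Sigma> intro: repl.Comma)
next
  case (CommaR \<Gamma>1 C)
  from CommaR.prems(2) obtain \<Sigma>1 \<Sigma>2
    where \<Sigma>: "\<Sigma> = (\<Sigma>1 \<^bold>, \<Sigma>2)" "repl \<alpha> \<Delta> (C\<langle>\<Gamma>\<rangle>) \<Sigma>2" "repl \<alpha> \<Delta> \<Gamma>1 \<Sigma>1"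
    by (auto simp: repl_simps)
  show ?case
    by (rule CommaR.IH[OF _ \<Sigma>(2)])
      (rule CommaR.prems(1)[of "CommaR \<Sigma>1 _"], auto simp: \<Sigma> intro: repl.Comma)
next
  case (CircC C)
  from CircC.prems(2) obtain \<Sigma>1 where \<Sigma>: "\<Sigma> = \<^bold>\<circ> \<Sigma>1" "repl \<alpha> \<Delta> (C\<langle>\<Gamma>\<rangle>) \<Sigma>1"
    by (auto simp: repl_simps)
  show ?case
    by (rule CircC.IH[OF _ \<Sigma>(2)])
      (rule CircC.prems(1)[of "CircC _"], auto simp: \<Sigma> intro: repl.Circ)
next
  case (BulC C)
  from BulC.prems(2) obtain \<Sigma>1 where \<Sigma>: "\<Sigma> = \<^bold>\<bullet> \<Sigma>1" "repl \<alpha> \<Delta> (C\<langle>\<Gamma>\<rangle>) \<Sigma>1"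
    by (auto simp: repl_simps)
  show ?case
    by (rule BulC.IH[OF _ \<Sigma>(2)])
      (rule BulC.prems(1)[of "BulC _"], auto simp: \<Sigma> intro: repl.Bul)
qed

text \<open>Rebracketing keeps the leaves and their order, so a selection of occurrences carries
  over. Both directions are proved together because \<open>sym\<close> interchanges them.\<close>

lemma repl_assoc_eq:
  assumes "\<Gamma> \<approx> \<Gamma>'"
  shows "(\<forall>\<Sigma>. repl \<alpha> \<Delta> \<Gamma> \<Sigma> \<longrightarrow> (\<exists>\<Sigma>'. repl \<alpha> \<Delta> \<Gamma>' \<Sigma>' \<and> \<Sigma> \<approx> \<Sigma>')) \<and>
    (\<forall>\<Sigma>'. repl \<alpha> \<Delta> \<Gamma>' \<Sigma>' \<longrightarrow> (\<exists>\<Sigma>. repl \<alpha> \<Delta> \<Gamma> \<Sigma> \<and> \<Sigma>' \<approx> \<Sigma>))"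
  using assms
proof induction
  case (assoc \<Gamma> \<Gamma>' \<Gamma>'')
  show ?case
    by (force simp: repl_simps intro: assoc_eq.assoc assoc_eq.assoc[THEN assoc_eq.sym])
next
  case (refl \<Gamma>)
  show ?case by (blast intro: assoc_eq.refl)
next
  case (sym \<Gamma> \<Gamma>')
  then show ?case by blast
next
  case (trans \<Gamma> \<Gamma>' \<Gamma>'')
  then show ?case by (blast intro: assoc_eq.trans)
next
  case (ctx \<Gamma> \<Gamma>' C)
  \<comment> \<open>Stated for arbitrary contents of the hole, so that one argument serves both
    directions.\<close>
  have "\<exists>\<Sigma>'. repl \<alpha> \<Delta> (C\<langle>\<Theta>'\<rangle>) \<Sigma>' \<and> \<Sigma> \<approx> \<Sigma>'"
    if "repl \<alpha> \<Delta> (C\<langle>\<Theta>\<rangle>) \<Sigma>" "\<forall>\<Sigma>. repl \<alpha> \<Delta> \<Theta> \<Sigma> \<longrightarrow> (\<exists>\<Sigma>'. repl \<alpha> \<Delta> \<Theta>' \<Sigma>' \<and> \<Sigma> \<approx> \<Sigma>')"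
    for \<Theta> \<Theta>' \<Sigma>
    using that(1)
  proof (rule repl_fillE)
    fix C' \<Sigma>1
    assume *: "\<Sigma> = C'\<langle>\<Sigma>1\<rangle>" "repl \<alpha> \<Delta> \<Theta> \<Sigma>1"
      "\<And>\<Xi> \<Xi>'. repl \<alpha> \<Delta> \<Xi> \<Xi>' \<Longrightarrow> repl \<alpha> \<Delta> (C\<langle>\<Xi>\<rangle>) (C'\<langle>\<Xi>'\<rangle>)"
    from that(2) *(2) obtain \<Sigma>2 where "repl \<alpha> \<Delta> \<Theta>' \<Sigma>2" "\<Sigma>1 \<approx> \<Sigma>2" by blast
    with *(1,3) show ?thesis by (auto intro: assoc_eq.ctx)
  qed
  with ctx.IH show ?case by simp
qed

section \<open>Cut elimination\<close>

text \<open>What the antecedent \<open>\<Delta>\<close> of a right introduction of \<open>\<alpha>\<close> must satisfy to replace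
  the principal formula of a left introduction of \<open>\<alpha>\<close>.\<close>

fun principal_cut :: "fm \<Rightarrow> struct \<Rightarrow> bool" where
  "principal_cut (a \<^bold>\<and> b) \<Delta> \<longleftrightarrow>
    (\<forall>C \<beta>. cut_free (Some (C\<langle>Fm a \<^bold>, Fm b\<rangle>) \<^bold>\<Rightarrow> \<beta>) \<longrightarrow> cut_free (Some (C\<langle>\<Delta>\<rangle>) \<^bold>\<Rightarrow> \<beta>))"
| "principal_cut (a \<^bold>\<or> b) \<Delta> \<longleftrightarrow>
    (\<forall>C \<beta>. cut_free (Some (C\<langle>Fm a\<rangle>) \<^bold>\<Rightarrow> \<beta>) \<longrightarrow> cut_free (Some (C\<langle>Fm b\<rangle>) \<^bold>\<Rightarrow> \<beta>) \<longrightarrow>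
      cut_free (Some (C\<langle>\<Delta>\<rangle>) \<^bold>\<Rightarrow> \<beta>))"
| "principal_cut (a \<^bold>\<rightarrow> b) \<Delta> \<longleftrightarrow>
    (\<forall>\<Sigma> C \<beta>. cut_free (Some \<Sigma> \<^bold>\<Rightarrow> a) \<longrightarrow> cut_free (Some (C\<langle>Fm b\<rangle>) \<^bold>\<Rightarrow> \<beta>) \<longrightarrow>
      cut_free (Some (C\<langle>\<Sigma> \<^bold>, \<Delta>\<rangle>) \<^bold>\<Rightarrow> \<beta>))"
| "principal_cut (\<^bold>\<diamond> a) \<Delta> \<longleftrightarrow>
    (\<forall>C \<beta>. cut_free (Some (C\<langle>\<^bold>\<circ> (Fm a)\<rangle>) \<^bold>\<Rightarrow> \<beta>) \<longrightarrow> cut_free (Some (C\<langle>\<Delta>\<rangle>) \<^bold>\<Rightarrow> \<beta>))"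
| "principal_cut (\<^bold>P a) \<Delta> \<longleftrightarrow>
    (\<forall>C \<beta>. cut_free (Some (C\<langle>\<^bold>\<bullet> (Fm a)\<rangle>) \<^bold>\<Rightarrow> \<beta>) \<longrightarrow> cut_free (Some (C\<langle>\<Delta>\<rangle>) \<^bold>\<Rightarrow> \<beta>))"
| "principal_cut (\<^bold>\<box> a) \<Delta> \<longleftrightarrow>
    (\<forall>C \<beta>. cut_free (Some (C\<langle>Fm a\<rangle>) \<^bold>\<Rightarrow> \<beta>) \<longrightarrow> cut_free (Some (C\<langle>\<^bold>\<bullet> \<Delta>\<rangle>) \<^bold>\<Rightarrow> \<beta>))"
| "principal_cut (\<^bold>\<box>\<^sub>P a) \<Delta> \<longleftrightarrow>
    (\<forall>C \<beta>. cut_free (Some (C\<langle>Fm a\<rangle>) \<^bold>\<Rightarrow> \<beta>) \<longrightarrow> cut_free (Some (C\<langle>\<^bold>\<circ> \<Delta>\<rangle>) \<^bold>\<Rightarrow> \<beta>))"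
| "principal_cut _ \<Delta> \<longleftrightarrow> True"

text \<open>The derivation of the sequent is replayed with the replacements made throughout. An
  axiom whose formula is replaced becomes the given derivation of \<Delta> \<Rightarrow> \<alpha>,
  and a replaced principal formula of a left rule is handled by
  \<open>principal_cut\<close>.\<close>

lemma cut_free_repl:
  assumes "cut_free (Some \<Gamma> \<^bold>\<Rightarrow> \<beta>)" "repl \<alpha> \<Delta> \<Gamma> \<Gamma>'"
    and \<Delta>: "cut_free (Some \<Delta> \<^bold>\<Rightarrow> \<alpha>)" "principal_cut \<alpha> \<Delta>"
  shows "cut_free (Some \<Gamma>' \<^bold>\<Rightarrow> \<beta>)"
  using assms(1,2)
proof (induction "Some \<Gamma> \<^bold>\<Rightarrow> \<beta>" arbitrary: \<Gamma> \<Gamma>' \<beta> rule: derivable.induct)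
  case (bracketing \<Gamma>0 \<gamma> \<Gamma>1)
  \<comment> \<open>The replacement is given for the conclusion and has to be carried back to the
    premise, hence the second half of \<open>repl_assoc_eq\<close>.\<close>
  obtain \<Sigma> where "repl \<alpha> \<Delta> \<Gamma>0 \<Sigma>" "\<Gamma>' \<approx> \<Sigma>"
    using repl_assoc_eq[OF bracketing.hyps(3), THEN conjunct2] bracketing.prems by blast
  then show ?case
    using cut_free_bracketing[OF bracketing.hyps(2) assoc_eq.sym] by blast
next
  case (rule r ps)
  have IH: "cut_free (Some \<Sigma>' \<^bold>\<Rightarrow> \<gamma>)" if "(Some \<Sigma> \<^bold>\<Rightarrow> \<gamma>) \<in> set ps" "repl \<alpha> \<Delta> \<Sigma> \<Sigma>'" for \<Sigma> \<gamma> \<Sigma>'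
    using rule(4)[OF that] .
  \<comment> \<open>The common pattern of the rules acting inside a context: \<Theta> is the part of
    the conclusion that the rule acts on, and the premises over \<open>C\<close> are available over
    the altered context \<open>C'\<close>.\<close>
  have step: "cut_free (Some \<Gamma>' \<^bold>\<Rightarrow> \<beta>)"
    if "\<Gamma> = C\<langle>\<Theta>\<rangle>"
      and "\<And>C' \<Theta>'. repl \<alpha> \<Delta> \<Theta> \<Theta>' \<Longrightarrow>
        (\<And>\<Sigma> \<Sigma>'. (Some (C\<langle>\<Sigma>\<rangle>) \<^bold>\<Rightarrow> \<beta>) \<in> set ps \<Longrightarrow> repl \<alpha> \<Delta> \<Sigma> \<Sigma>' \<Longrightarrow> cut_free (Some (C'\<langle>\<Sigma>'\<rangle>) \<^bold>\<Rightarrow> \<beta>)) \<Longrightarrow>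
        cut_free (Some (C'\<langle>\<Theta>'\<rangle>) \<^bold>\<Rightarrow> \<beta>)"
    for C \<Theta>
  proof -
    from rule.prems[unfolded that(1)] obtain C' \<Theta>' where "\<Gamma>' = C'\<langle>\<Theta>'\<rangle>" "repl \<alpha> \<Delta> \<Theta> \<Theta>'"
      "\<And>\<Sigma> \<Sigma>'. repl \<alpha> \<Delta> \<Sigma> \<Sigma>' \<Longrightarrow> repl \<alpha> \<Delta> (C\<langle>\<Sigma>\<rangle>) (C'\<langle>\<Sigma>'\<rangle>)"
      by (rule repl_fillE) blast
    with IH that(2) show ?thesis by simp
  qed
  from rule(2) show ?case
  proof cases
    case Id
    then show ?thesis using rule.prems \<Delta>(1) by (auto simp: repl_simps intro: cut_free_intros)
  next
    case TopRule
    show ?thesis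
      by (rule step, simp add: TopRule)
        (use TopRule in \<open>auto simp: repl_simps intro: cut_free_intros(2)\<close>)
  next
    case BotRule
    show ?thesis
      by (rule step, simp add: BotRule) (rule cut_free_intros(3), rule IH, use BotRule in auto)
  next
    case (AndL C a b)
    show ?thesis
      by (rule step, simp add: AndL) (use AndL \<Delta>(2) in \<open>auto simp: repl_simps intro: cut_free_intros(4)\<close>)
  next
    case AndR
    then show ?thesis using rule.prems by (auto intro!: cut_free_intros(5) IH[of \<Gamma>])
  next
    case (OrL C a b)
    show ?thesis
    proof (rule step, simp add: OrL)
      fix C' \<Theta>'
      assume \<Theta>': "repl \<alpha> \<Delta> (Fm (a \<^bold>\<or> b)) \<Theta>'"
        and prem: "\<And>\<Sigma> \<Sigma>'. (Some (C\<langle>\<Sigma>\<rangle>) \<^bold>\<Rightarrow> \<beta>) \<in> set ps \<Longrightarrow> repl \<alpha> \<Delta> \<Sigma> \<Sigma>' \<Longrightarrow>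
          cut_free (Some (C'\<langle>\<Sigma>'\<rangle>) \<^bold>\<Rightarrow> \<beta>)"
      \<comment> \<open>\<open>leaf\<close> keeps the new formulas of the premises even if one of
        them is \<alpha>. The principal disjunction itself is either kept, and \<open>OrL\<close> is
        applied again, or replaced, and \<open>principal_cut\<close> applies.\<close>
      have "cut_free (Some (C'\<langle>Fm a\<rangle>) \<^bold>\<Rightarrow> \<beta>)" "cut_free (Some (C'\<langle>Fm b\<rangle>) \<^bold>\<Rightarrow> \<beta>)"
        by (rule prem[OF _ repl.leaf], simp add: OrL)+
      with \<Theta>' \<Delta>(2) show "cut_free (Some (C'\<langle>\<Theta>'\<rangle>) \<^bold>\<Rightarrow> \<beta>)"
        by (auto simp: repl_simps intro: cut_free_intros(6))
    qed
  next
    case OrR1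
    then show ?thesis using rule.prems by (auto intro!: cut_free_intros(7) IH[of \<Gamma>])
  next
    case OrR2
    then show ?thesis using rule.prems by (auto intro!: cut_free_intros(8) IH[of \<Gamma>])
  next
    case (ImpL \<Sigma> a C b)
    show ?thesis
    proof (rule step, simp add: ImpL)
      fix C' \<Theta>'
      assume \<Theta>': "repl \<alpha> \<Delta> (\<Sigma> \<^bold>, Fm (a \<^bold>\<rightarrow> b)) \<Theta>'"
        and prem: "\<And>\<Sigma> \<Sigma>'. (Some (C\<langle>\<Sigma>\<rangle>) \<^bold>\<Rightarrow> \<beta>) \<in> set ps \<Longrightarrow> repl \<alpha> \<Delta> \<Sigma> \<Sigma>' \<Longrightarrow>
          cut_free (Some (C'\<langle>\<Sigma>'\<rangle>) \<^bold>\<Rightarrow> \<beta>)"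
      have "cut_free (Some (C'\<langle>Fm b\<rangle>) \<^bold>\<Rightarrow> \<beta>)"
        by (rule prem[OF _ repl.leaf]) (simp add: ImpL)
      \<comment> \<open>The left premise has no surrounding context, so its antecedent is replaced
        through the induction hypothesis directly.\<close>
      moreover have "cut_free (Some \<Sigma>' \<^bold>\<Rightarrow> a)" if "repl \<alpha> \<Delta> \<Sigma> \<Sigma>'" for \<Sigma>'
        by (rule IH[OF _ that]) (simp add: ImpL)
      ultimately show "cut_free (Some (C'\<langle>\<Theta>'\<rangle>) \<^bold>\<Rightarrow> \<beta>)"
        using \<Theta>' \<Delta>(2) by (auto simp: repl_simps intro: cut_free_intros(9))
    qed
  next
    case (ImpR a b)
    then show ?thesis using rule.prems
      by (auto simp: repl_simps intro!: cut_free_intros(10) IH[of "Fm a \<^bold>, \<Gamma>"])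
  next
    case (DiaL C a)
    show ?thesis
      by (rule step, simp add: DiaL) (use DiaL \<Delta>(2) in \<open>auto simp: repl_simps intro: cut_free_intros(11)\<close>)
  next
    case (DiaR \<Sigma> a)
    then show ?thesis using rule.prems by (auto simp: repl_simps intro!: cut_free_intros(12) IH[of \<Sigma>])
  next
    case (PastL C a)
    show ?thesis
      by (rule step, simp add: PastL) (use PastL \<Delta>(2) in \<open>auto simp: repl_simps intro: cut_free_intros(13)\<close>)
  next
    case (PastR \<Sigma> a)
    then show ?thesis using rule.prems by (auto simp: repl_simps intro!: cut_free_intros(14) IH[of \<Sigma>])
  next
    case (BBoxL C a)
    show ?thesis
      by (rule step, simp add: BBoxL) (use BBoxL \<Delta>(2) in \<open>auto simp: repl_simps intro: cut_free_intros(15)\<close>)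
  next
    case BBoxR
    then show ?thesis using rule.prems by (auto simp: repl_simps intro!: cut_free_intros(16) IH[of "\<^bold>\<circ> \<Gamma>"])
  next
    case (BoxL C a)
    show ?thesis
      by (rule step, simp add: BoxL) (use BoxL \<Delta>(2) in \<open>auto simp: repl_simps intro: cut_free_intros(17)\<close>)
  next
    case BoxR
    then show ?thesis using rule.prems by (auto simp: repl_simps intro!: cut_free_intros(18) IH[of "\<^bold>\<bullet> \<Gamma>"])
  next
    case ConCirc
    show ?thesis
      by (rule step, simp add: ConCirc)
        (use ConCirc in \<open>auto simp: repl_simps intro: cut_free_intros(19)\<close>)
  next
    case ConBul
    show ?thesis
      by (rule step, simp add: ConBul)
        (use ConBul in \<open>auto simp: repl_simps intro: cut_free_intros(20)\<close>)
  next
    \<comment> \<open>Both copies in the premise get the same replacement. If it is \<Delta>, then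
      \<open>ConF\<close> no longer applies and structural contraction takes its place.\<close>
    case ConF
    show ?thesis
      by (rule step, simp add: ConF)
        (use ConF in \<open>auto simp: repl_simps intro: cut_free_contraction\<close>)
  next
    case Wk1
    show ?thesis
      by (rule step, simp add: Wk1)
        (use Wk1 in \<open>auto simp: repl_simps intro: cut_free_intros(22)\<close>)
  next
    case Wk2
    show ?thesis
      by (rule step, simp add: Wk2)
        (use Wk2 in \<open>auto simp: repl_simps intro: cut_free_intros(23)\<close>)
  next
    case Ex
    show ?thesis
      by (rule step, simp add: Ex)
        (use Ex in \<open>auto simp: repl_simps intro: cut_free_intros(24)\<close>)
  next
    \<comment> \<open>The premise shares neither context nor succedent with the conclusion, so the
      replacement is made in its whole antecedent.\<close>
    case DualCircBul
    show ?thesis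
      by (rule step, simp add: DualCircBul) (use DualCircBul in
          \<open>auto simp: repl_simps intro!: cut_free_intros(25) IH[of "_ \<^bold>, _"]\<close>)
  next
    case DualBulCirc
    show ?thesis
      by (rule step, simp add: DualBulCirc) (use DualBulCirc in
          \<open>auto simp: repl_simps intro!: cut_free_intros(26) IH[of "_ \<^bold>, _"]\<close>)
  next
    case Cut
    with rule(1) show ?thesis by simp
  qed
qed

text \<open>The rules acting inside a context, with a further context \<open>D\<close> put around
  their own one. This is the form in which they are applied again below a cut into
  \<open>D\<close>.\<close>

lemmas cut_free_nested =
  cut_free_intros(2,3,4,6,9,11,13,15,17,19,20,21,22,23,24,25,26)
    [where C = "ctx_comp D C" for C D, unfolded fill_ctx_comp]

section \<open>Reduction of a cut to cuts on smaller formulas\<close>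

definition cut_admissible :: "fm \<Rightarrow> bool" where
  "cut_admissible \<alpha> \<longleftrightarrow> (\<forall>\<Delta> C \<beta>. cut_free (Some \<Delta> \<^bold>\<Rightarrow> \<alpha>) \<longrightarrow> cut_free (Some (C\<langle>Fm \<alpha>\<rangle>) \<^bold>\<Rightarrow> \<beta>) \<longrightarrow>
    cut_free (Some (C\<langle>\<Delta>\<rangle>) \<^bold>\<Rightarrow> \<beta>))"

lemma cut_admissibleD:
  assumes "cut_admissible \<alpha>" "cut_free (Some (C\<langle>Fm \<alpha>\<rangle>) \<^bold>\<Rightarrow> \<beta>)" "cut_free (Some \<Delta> \<^bold>\<Rightarrow> \<alpha>)"
  shows "cut_free (Some (C\<langle>\<Delta>\<rangle>) \<^bold>\<Rightarrow> \<beta>)"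
  using assms by (auto simp: cut_admissible_def)

text \<open>Cutting on both conjuncts leaves two copies of \<Delta>, which structural contraction
  merges.\<close>

lemma principal_cut_And:
  assumes "cut_admissible a" "cut_admissible b"
    and "cut_free (Some \<Delta> \<^bold>\<Rightarrow> a)" "cut_free (Some \<Delta> \<^bold>\<Rightarrow> b)"
  shows "principal_cut (a \<^bold>\<and> b) \<Delta>"
proof (simp, intro allI impI)
  fix C \<beta>
  assume "cut_free (Some (C\<langle>Fm a \<^bold>, Fm b\<rangle>) \<^bold>\<Rightarrow> \<beta>)"
  then have "cut_free (Some (C\<langle>\<Delta> \<^bold>, Fm b\<rangle>) \<^bold>\<Rightarrow> \<beta>)"
    using cut_admissibleD[OF assms(1), of "ctx_comp C (CommaL Hole (Fm b))"] assms(3)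
    by (simp add: fill_ctx_comp)
  then have "cut_free (Some (C\<langle>\<Delta> \<^bold>, \<Delta>\<rangle>) \<^bold>\<Rightarrow> \<beta>)"
    using cut_admissibleD[OF assms(2), of "ctx_comp C (CommaR \<Delta> Hole)"] assms(4)
    by (simp add: fill_ctx_comp)
  then show "cut_free (Some (C\<langle>\<Delta>\<rangle>) \<^bold>\<Rightarrow> \<beta>)" by (rule cut_free_contraction)
qed

text \<open>A cut on \<open>a\<close> turns the premise of \<open>ImpR\<close> into a derivation of
  \<open>b\<close> from \<Sigma> and \<Delta>; a cut on \<open>b\<close> then puts these two into
  the context.\<close>

lemma principal_cut_Imp:
  assumes "cut_admissible a" "cut_admissible b" "cut_free (Some (Fm a \<^bold>, \<Delta>) \<^bold>\<Rightarrow> b)"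
  shows "principal_cut (a \<^bold>\<rightarrow> b) \<Delta>"
  using cut_admissibleD[OF assms(1), of "CommaL Hole \<Delta>" b] cut_admissibleD[OF assms(2)] assms(3)
  by auto

text \<open>The left and the right rule use the same structural modality, so the cut on
  \<open>a\<close> is made beneath it.\<close>

lemma principal_cut_Dia:
  assumes "cut_admissible a" "cut_free (Some \<Delta> \<^bold>\<Rightarrow> a)"
  shows "principal_cut (\<^bold>\<diamond> a) (\<^bold>\<circ> \<Delta>)"
  using cut_admissibleD[OF assms(1), of "ctx_comp C (CircC Hole)" for C] assms(2)
  by (simp add: fill_ctx_comp)

lemma principal_cut_Past:
  assumes "cut_admissible a" "cut_free (Some \<Delta> \<^bold>\<Rightarrow> a)"
  shows "principal_cut (\<^bold>P a) (\<^bold>\<bullet> \<Delta>)"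
  using cut_admissibleD[OF assms(1), of "ctx_comp C (BulC Hole)" for C] assms(2)
  by (simp add: fill_ctx_comp)

lemma cut_reduction:
  assumes sub: "\<And>a. size a < size \<alpha> \<Longrightarrow> cut_admissible a"
    and "cut_free (Some \<Delta> \<^bold>\<Rightarrow> \<alpha>)" and D: "cut_free (Some (D\<langle>Fm \<alpha>\<rangle>) \<^bold>\<Rightarrow> \<gamma>)"
  shows "cut_free (Some (D\<langle>\<Delta>\<rangle>) \<^bold>\<Rightarrow> \<gamma>)"
  using assms(2)
proof (induction "Some \<Delta> \<^bold>\<Rightarrow> \<alpha>" arbitrary: \<Delta> rule: derivable.induct)
  case (bracketing \<Gamma> \<Gamma>')
  then show ?case by (auto intro: cut_free_bracketing assoc_eq.ctx)
next
  case (rule r ps)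
  have ps: "\<forall>p\<in>set ps. cut_free p"
    using rule(3) by blast
  have IH: "cut_free (Some (D\<langle>\<Sigma>\<rangle>) \<^bold>\<Rightarrow> \<gamma>)" if "(Some \<Sigma> \<^bold>\<Rightarrow> \<alpha>) \<in> set ps" for \<Sigma>
    using rule(4)[OF that] .
  have "cut_free (Some \<Delta> \<^bold>\<Rightarrow> \<alpha>)"
    using derivable.rule[OF rule(1-3)] .
  \<comment> \<open>A cut is the replacement of the single occurrence of \<alpha> at the hole of
    \<open>D\<close>.\<close>
  then have principal: "cut_free (Some (D\<langle>\<Delta>\<rangle>) \<^bold>\<Rightarrow> \<gamma>)" if "principal_cut \<alpha> \<Delta>"
    using cut_free_repl[OF D repl_fill[OF repl.hit]] that by blast
  from rule(2) show ?case
  proof cases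
    case Id
    with D show ?thesis by simp
  next
    case (AndR a b)
    with ps show ?thesis by (intro principal)
        (auto intro!: principal_cut_And sub simp del: principal_cut.simps)
  next
    \<comment> \<open>Of the two premises of the left rule, only the one for the derived disjunct is
      cut with.\<close>
    case (OrR1 a b)
    with ps show ?thesis by (intro principal) (auto intro!: cut_admissibleD[where \<alpha> = a] sub)
  next
    case (OrR2 b a)
    with ps show ?thesis by (intro principal) (auto intro!: cut_admissibleD[where \<alpha> = b] sub)
  next
    case (ImpR a b)
    with ps show ?thesis by (intro principal)
        (auto intro!: principal_cut_Imp sub simp del: principal_cut.simps)
  next
    case (DiaR \<Gamma> a)
    with ps show ?thesis by (intro principal)
        (auto intro!: principal_cut_Dia sub simp del: principal_cut.simps)
  next
    case (PastR \<Gamma> a)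
    with ps show ?thesis by (intro principal)
        (auto intro!: principal_cut_Past sub simp del: principal_cut.simps)
  next
    \<comment> \<open>The premise of \<open>BBoxR\<close> derives \<open>a\<close> from \<Delta>
      under the modality, exactly the structure that \<open>principal_cut\<close> puts in place of
      \<open>a\<close>.\<close>
    case (BBoxR a)
    with ps show ?thesis by (intro principal) (auto intro!: cut_admissibleD[where \<alpha> = a] sub)
  next
    case (BoxR a)
    with ps show ?thesis by (intro principal) (auto intro!: cut_admissibleD[where \<alpha> = a] sub)
  next
    case Cut
    with rule(1) show ?thesis by simp
  next
    \<comment> \<open>From here on the last rule acts on the antecedent. It is applied again inside
      \<open>D\<close>: premises with succedent \<alpha> have already been cut by the induction
      hypothesis, all others are used unchanged.\<close>
    case TopRule
    show ?thesis
      by (unfold TopRule, rule cut_free_nested(1)[where D = D])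
        (use ps in \<open>simp_all add: IH TopRule\<close>)
  next
    case BotRule
    show ?thesis
      by (unfold BotRule, rule cut_free_nested(2)[where D = D])
        (use ps in \<open>simp_all add: IH BotRule\<close>)
  next
    case AndL
    show ?thesis
      by (unfold AndL, rule cut_free_nested(3)[where D = D])
        (use ps in \<open>simp_all add: IH AndL\<close>)
  next
    case OrL
    show ?thesis
      by (unfold OrL, rule cut_free_nested(4)[where D = D])
        (use ps in \<open>simp_all add: IH OrL\<close>)
  next
    case ImpL
    show ?thesis
      by (unfold ImpL, rule cut_free_nested(5)[where D = D])
        (use ps in \<open>simp_all add: IH ImpL\<close>)
  next
    case DiaL
    show ?thesis
      by (unfold DiaL, rule cut_free_nested(6)[where D = D])
        (use ps in \<open>simp_all add: IH DiaL\<close>)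
  next
    case PastL
    show ?thesis
      by (unfold PastL, rule cut_free_nested(7)[where D = D])
        (use ps in \<open>simp_all add: IH PastL\<close>)
  next
    case BBoxL
    show ?thesis
      by (unfold BBoxL, rule cut_free_nested(8)[where D = D])
        (use ps in \<open>simp_all add: IH BBoxL\<close>)
  next
    case BoxL
    show ?thesis
      by (unfold BoxL, rule cut_free_nested(9)[where D = D])
        (use ps in \<open>simp_all add: IH BoxL\<close>)
  next
    case ConCirc
    show ?thesis
      by (unfold ConCirc, rule cut_free_nested(10)[where D = D])
        (use ps in \<open>simp_all add: IH ConCirc\<close>)
  next
    case ConBul
    show ?thesis
      by (unfold ConBul, rule cut_free_nested(11)[where D = D])
        (use ps in \<open>simp_all add: IH ConBul\<close>)
  next
    case ConF
    show ?thesis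
      by (unfold ConF, rule cut_free_nested(12)[where D = D])
        (use ps in \<open>simp_all add: IH ConF\<close>)
  next
    case Wk1
    show ?thesis
      by (unfold Wk1, rule cut_free_nested(13)[where D = D])
        (use ps in \<open>simp_all add: IH Wk1\<close>)
  next
    case Wk2
    show ?thesis
      by (unfold Wk2, rule cut_free_nested(14)[where D = D])
        (use ps in \<open>simp_all add: IH Wk2\<close>)
  next
    case Ex
    show ?thesis
      by (unfold Ex, rule cut_free_nested(15)[where D = D])
        (use ps in \<open>simp_all add: IH Ex\<close>)
  next
    case DualCircBul
    show ?thesis
      by (unfold DualCircBul, rule cut_free_nested(16)[where D = D])
        (use ps in \<open>simp_all add: IH DualCircBul\<close>)
  next
    case DualBulCirc
    show ?thesis
      by (unfold DualBulCirc, rule cut_free_nested(17)[where D = D])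
        (use ps in \<open>simp_all add: IH DualBulCirc\<close>)
  qed
qed

text \<open>Course-of-values induction on size, since the reduction cuts on immediate
  subformulas.\<close>

lemma cut_admissible: "cut_admissible \<alpha>"
proof (induction \<alpha> rule: measure_induct_rule[where f = size])
  case (less \<alpha>)
  then show ?case by (auto simp: cut_admissible_def[of \<alpha>] intro: cut_reduction)
qed

theorem theorem2:
  fixes s :: sequent
  assumes "derivable GwIKt s"
  shows "derivable (GwIKt - {Cut}) s"
  using assms
proof induction
  case (rule r ps s)
  show ?case
  \<comment> \<open>Cuts disappear from the top of the derivation downwards: the premises of a
    \<open>Cut\<close> are already cut-free by the induction hypothesis.\<close>
  proof (cases "r = Cut")
    case True
    have "\<forall>p\<in>set ps. cut_free p" using rule.IH by blast
    with rule.hyps(2) True show ?thesis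
      by cases (auto intro: cut_admissibleD[OF cut_admissible])
  next
    case False
    with rule show ?thesis by (intro cut_free_rule) auto
  qed
next
  case (bracketing \<Gamma> \<beta> \<Gamma>')
  from bracketing.IH bracketing.hyps(2) show ?case by (rule cut_free_bracketing)
qed

end
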